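(* Let $\mathcal{T}$ be a staged tree. Then $$\ker\varphi_{\mathrm{toric}}=\ker\varphi$$ if and only if the following condition holds for all vertices $v,w$ of $\mathcal{T}$ which are in the same stage: writing $E(v)=\{(v,v_1),\ldots,(v,v_k)\}$ and $E(w)=\{(w,w_1),\ldots,(w,w_k)\}$ with $\theta(v,v_i)=\theta(w,w_i)$ for $i=1,\ldots,k$, the equation $$t(v_i)\,t(w_j)=t(w_i)\,t(v_j)\qquad\text{for all } i,j=1,\ldots,k$$ is true in the polynomial ring $\mathbb{R}[\Theta]$.
   Context: A tree $\mathcal{T}=(V,E)$ is a finite directed rooted tree with root $v_0$ and at least one edge, edges directed away from the root, in which every vertex has either no or at least two outgoing edges. $E(v)\subseteq E$ is the set of edges going out of $v$. A staged tree is such a tree together with an edge labelling $e\mapsto\theta(e)$ and an equivalence relation $\sim$ on the non-leaf vertices ($v\sim w$ is read "$v$ and $w$ are in the same stage"), such that the edges out of one vertex have pairwise distinct labels, the sets of labels on $E(v)$ and $E(w)$ coincide if $v\sim w$, and these sets are disjoint if $v\not\sim w$. $\mathbb{R}[\Theta]=\mathbb{R}[\theta(e)\mid e\in E]$ is the polynomial ring with one indeterminate for each distinct label. Let $\lambda_1,\ldots,\lambda_n$ be the root-to-leaf paths and $E(\lambda_i)$ the edge set of $\lambda_i$. Define the ring map $$\varphi_{\mathrm{toric}}:\mathbb{R}[p_1,\ldots,p_n]\to\mathbb{R}[\Theta],\quad p_i\mapsto\prod_{e\in E(\lambda_i)}\theta(e),$$ and let $\varphi:\mathbb{R}[p_1,\ldots,p_n]\to\mathbb{R}[\Theta]/\langle\theta-1\rangle$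 be its composition with the quotient map, where $\langle\theta-1\rangle=\langle\sum_{e\in E(v)}\theta(e)-1\mid v\in V\text{ non-leaf}\rangle$. Convention: $\ker\varphi$ is considered as a homogeneous ideal, that is, $\ker\varphi$ here denotes the ideal of $\mathbb{R}[p_1,\ldots,p_n]$ generated by all homogeneous polynomials (standard grading) mapped to $0$ by $\varphi$. For $v\in V$, $t(v)\in\mathbb{R}[\Theta]$ is the sum, over all leaves $\ell$ of $\mathcal{T}$ that are descendants of $v$ (or equal to $v$), of the products $\prod_{e}\theta(e)$ over the edges $e$ of the path from $v$ to $\ell$; so $t(v)=1$ if $v$ is a leaf. *)

theory Defs
  imports
    "HOL-Library.Poly_Mapping"
    "HOL-Algebra.QuotRing"
    "Graph_Theory.Digraph"
    "Graph_Theory.Arc_Walk"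
begin

section \<open>Polynomial rings\<close>

text \<open>
  Monomials are finitely supported exponent vectors and polynomials are finitely supported
  coefficient functions on monomials; the arithmetic is that of \<^theory>\<open>HOL-Library.Poly_Mapping\<close>.
  The type has one indeterminate for every element of \<open>'x\<close>, so the ring in a prescribed set
  \<open>X\<close> of indeterminates is obtained by restricting the carrier.
\<close>

type_synonym 'x mpol = "('x \<Rightarrow>\<^sub>0 nat) \<Rightarrow>\<^sub>0 real"

definition mvar :: "'x \<Rightarrow> 'x mpol" where
  "mvar x = Poly_Mapping.single (Poly_Mapping.single x 1) 1"

definition mconst :: "real \<Rightarrow> 'x mpol" where
  "mconst c = Poly_Mapping.single 0 c"

definition mpol_ring :: "'x set \<Rightarrow> 'x mpol ring" where
  "mpol_ring X =
    \<lparr>carrier = {f. \<forall>m \<in> Poly_Mapping.keys f. Poly_Mapping.keys m \<subseteq> X},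
     mult = (*), one = 1, zero = 0, add = (+)\<rparr>"

definition mpol_subst :: "('x \<Rightarrow> 'y mpol) \<Rightarrow> 'x mpol \<Rightarrow> 'y mpol" where
  "mpol_subst g f =
    (\<Sum>m \<in> Poly_Mapping.keys f. mconst (Poly_Mapping.lookup f m) *
       (\<Prod>x \<in> Poly_Mapping.keys m. g x ^ Poly_Mapping.lookup m x))"

definition mono_degree :: "('x \<Rightarrow>\<^sub>0 nat) \<Rightarrow> nat" where
  "mono_degree m = (\<Sum>x \<in> Poly_Mapping.keys m. Poly_Mapping.lookup m x)"

definition homogeneous :: "'x mpol \<Rightarrow> bool" where
  "homogeneous f \<longleftrightarrow> (\<exists>d. \<forall>m \<in> Poly_Mapping.keys f. mono_degree m = d)"

lemma mpol_ring_simps [simp]: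
  "f \<in> carrier (mpol_ring X) \<longleftrightarrow> (\<forall>m \<in> Poly_Mapping.keys f. Poly_Mapping.keys m \<subseteq> X)"
  "mult (mpol_ring X) = (*)" "one (mpol_ring X) = 1"
  "zero (mpol_ring X) = 0" "add (mpol_ring X) = (+)"
  by (simp_all add: mpol_ring_def)

lemma cring_mpol_ring: "cring (mpol_ring X)"
proof (rule cringI)
  have add: "f + g \<in> carrier (mpol_ring X)"
    if "f \<in> carrier (mpol_ring X)" "g \<in> carrier (mpol_ring X)" for f g
    using that Poly_Mapping.keys_add[of f g] by auto
  have mult: "f * g \<in> carrier (mpol_ring X)"
    if f: "f \<in> carrier (mpol_ring X)" and g: "g \<in> carrier (mpol_ring X)" for f g
    unfolding mpol_ring_simps
  proof
    fix m assume "m \<in> Poly_Mapping.keys (f * g)"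
    then obtain a b where m: "m = a + b" "a \<in> Poly_Mapping.keys f" "b \<in> Poly_Mapping.keys g"
      using keys_mult[of f g] by blast
    have "Poly_Mapping.keys a \<subseteq> X" "Poly_Mapping.keys b \<subseteq> X"
      using f g m by simp_all
    then have "Poly_Mapping.keys a \<union> Poly_Mapping.keys b \<subseteq> X" by (rule Un_least)
    with Poly_Mapping.keys_add show "Poly_Mapping.keys m \<subseteq> X"
      unfolding m(1) by (rule subset_trans)
  qed
  have zero: "0 \<in> carrier (mpol_ring X)"
    and one: "1 \<in> carrier (mpol_ring X)" by simp_all
  show "abelian_group (mpol_ring X)"
  proof (rule abelian_groupI)
    fix f assume f: "f \<in> carrier (mpol_ring X)"
    have "- f \<in> carrier (mpol_ring X)" using f by simp
    then show "\<exists>g \<in> carrier (mpol_ring X). g \<oplus>\<^bsub>mpol_ring X\<^esub> f = \<zero>\<^bsub>mpol_ring X\<^esub>"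
      by (intro bexI[of _ "- f"]) simp_all
  qed (simp_all add: add zero ac_simps del: mpol_ring_simps(1))
  show "Group.comm_monoid (mpol_ring X)"
    by (rule comm_monoidI)
      (simp_all add: mult one ac_simps del: mpol_ring_simps(1))
qed (simp add: distrib_right del: mpol_ring_simps(1))

lemma mpol_subst_superset:
  assumes "finite A" "Poly_Mapping.keys f \<subseteq> A"
  shows "mpol_subst g f = (\<Sum>m \<in> A. mconst (Poly_Mapping.lookup f m) *
    (\<Prod>x \<in> Poly_Mapping.keys m. g x ^ Poly_Mapping.lookup m x))"
  unfolding mpol_subst_def using assms
  by (intro sum.mono_neutral_left) (auto simp: mconst_def in_keys_iff)

lemma mpol_subst_add: "mpol_subst g (f + h) = mpol_subst g f + mpol_subst g h"
proof -
  let ?A = "Poly_Mapping.keys f \<union> Poly_Mapping.keys h"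
  have "finite ?A" by simp
  note s = mpol_subst_superset[OF this, of _ g]
  show ?thesis
    using Poly_Mapping.keys_add[of f h]
    by (simp add: s lookup_add mconst_def single_add distrib_right sum.distrib)
qed

lemma mpol_subst_single:
  "mpol_subst g (Poly_Mapping.single m c) =
    mconst c * (\<Prod>x \<in> Poly_Mapping.keys m. g x ^ Poly_Mapping.lookup m x)"
  by (cases "c = 0") (simp_all add: mpol_subst_def mconst_def)

lemma mpol_subst_mvar [simp]: "mpol_subst g (mvar x) = g x"
  by (simp add: mvar_def mpol_subst_single mconst_def)

lemma mpol_subst_mconst [simp]: "mpol_subst g (mconst c) = mconst c"
  by (simp add: mpol_subst_single mconst_def)

lemma mpol_induct [case_names single sum]:
  fixes f :: "'x mpol"
  assumes single: "\<And>m c. P (Poly_Mapping.single m c)"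
    and sum: "\<And>f h. \<lbrakk>P f; P h\<rbrakk> \<Longrightarrow> P (f + h)"
  shows "P f"
proof (induction "Poly_Mapping.keys f" arbitrary: f rule: infinite_finite_induct)
  case empty
  then have "f = 0" by (metis keys_eq_empty)
  then show ?case using single[of 0 0] by simp
next
  case (insert m A)
  define h where "h = f - Poly_Mapping.single m (Poly_Mapping.lookup f m)"
  have "Poly_Mapping.lookup h x = (if x = m then 0 else Poly_Mapping.lookup f x)" for x
    by (simp add: h_def lookup_minus lookup_single)
  then have "Poly_Mapping.keys h = Poly_Mapping.keys f - {m}"
    by (auto simp only: in_keys_iff split: if_splits)
  then have "Poly_Mapping.keys h = A"
    using insert.hyps by blast
  then have "P h" by (intro insert.hyps(3)) (rule sym)
  moreover have "f = Poly_Mapping.single m (Poly_Mapping.lookup f m) + h" by (simp add: h_def)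
  ultimately show ?case using single sum by metis
qed simp

lemma mpol_subst_mult:
  fixes g :: "'x \<Rightarrow> 'y mpol"
  shows "mpol_subst g (f * h) = mpol_subst g f * mpol_subst g h"
proof -
  have mono: "(\<Prod>x \<in> Poly_Mapping.keys (a + b). g x ^ Poly_Mapping.lookup (a + b) x) =
      (\<Prod>x \<in> Poly_Mapping.keys a. g x ^ Poly_Mapping.lookup a x) *
      (\<Prod>x \<in> Poly_Mapping.keys b. g x ^ Poly_Mapping.lookup b x)" for a b :: "'x \<Rightarrow>\<^sub>0 nat"
  proof -
    let ?A = "Poly_Mapping.keys a \<union> Poly_Mapping.keys b"
    have ext: "(\<Prod>x \<in> Poly_Mapping.keys m. g x ^ Poly_Mapping.lookup m x) =
        (\<Prod>x \<in> ?A. g x ^ Poly_Mapping.lookup m x)" if "Poly_Mapping.keys m \<subseteq> ?A" for m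
      using that by (intro prod.mono_neutral_left) (auto simp: in_keys_iff)
    have k: "Poly_Mapping.keys (a + b) \<subseteq> ?A" by (rule Poly_Mapping.keys_add)
    show ?thesis
      unfolding ext[OF k] ext[OF Un_upper1] ext[OF Un_upper2]
      by (simp only: lookup_add power_add prod.distrib)
  qed
  have singles: "mpol_subst g (Poly_Mapping.single a c * Poly_Mapping.single b d) =
      mpol_subst g (Poly_Mapping.single a c) * mpol_subst g (Poly_Mapping.single b d)" for a b c d
  proof -
    have "mconst (c * d) = (mconst c * mconst d :: 'y mpol)"
      by (simp add: mconst_def mult_single)
    then show ?thesis
      unfolding mult_single mpol_subst_single mono by (simp only: mult.assoc mult.left_commute)
  qed
  have left: "mpol_subst g (Poly_Mapping.single a c * h) =
      mpol_subst g (Poly_Mapping.single a c) * mpol_subst g h" for a c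
  proof (induction h rule: mpol_induct)
    case (single k v) then show ?case by (rule singles)
  next
    case (sum h1 h2) then show ?case by (simp only: distrib_left mpol_subst_add)
  qed
  show ?thesis
  proof (induction f rule: mpol_induct)
    case (single k v) then show ?case by (rule left)
  next
    case (sum h1 h2) then show ?case by (simp only: distrib_right mpol_subst_add)
  qed
qed


section \<open>Staged trees\<close>

text \<open>
  The predicate \<open>tree\<close> of the graph library is not used: it only asks for a connected digraph
  without directed cycles and has no root. Uniqueness of the walk from the root to every vertex
  excludes undirected cycles, loops and parallel arcs, and directs every arc away from the root.
\<close>

locale rooted_tree = fin_digraph G for G :: "('v, 'e) pre_digraph" (structure) +
  fixes v0 :: 'v
  assumes root_in_verts: "v0 \<in> verts G"
    and unique_walk_from_root: "v \<in> verts G \<Longrightarrow> \<exists>!p. awalk v0 p v"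

definition leaves :: "('v, 'e) pre_digraph \<Rightarrow> 'v set" where
  "leaves G = {v \<in> verts G. out_arcs G v = {}}"

definition nonleaves :: "('v, 'e) pre_digraph \<Rightarrow> 'v set" where
  "nonleaves G = verts G - leaves G"

locale staged_tree = rooted_tree G v0
  for G :: "('v, 'e) pre_digraph" (structure) and v0 :: 'v +
  fixes \<theta> :: "'e \<Rightarrow> 'l" and stage :: "('v \<times> 'v) set"
  assumes has_arc: "arcs G \<noteq> {}"
    and branching: "v \<in> nonleaves G \<Longrightarrow> out_degree G v \<ge> 2"
    and equiv_stage: "equiv (nonleaves G) stage"
    and labels_distinct: "v \<in> nonleaves G \<Longrightarrow> inj_on \<theta> (out_arcs G v)"
    and same_stage: "(v, w) \<in> stage \<Longrightarrow> \<theta> ` out_arcs G v = \<theta> ` out_arcs G w"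
    and different_stage: "\<lbrakk>v \<in> nonleaves G; w \<in> nonleaves G; (v, w) \<notin> stage\<rbrakk>
      \<Longrightarrow> \<theta> ` out_arcs G v \<inter> \<theta> ` out_arcs G w = {}"

definition root_leaf_paths :: "('v, 'e) pre_digraph \<Rightarrow> 'v \<Rightarrow> 'e awalk set" where
  "root_leaf_paths G v0 = {p. \<exists>l \<in> leaves G. pre_digraph.awalk G v0 p l}"

definition path_between :: "('v, 'e) pre_digraph \<Rightarrow> 'v \<Rightarrow> 'v \<Rightarrow> 'e awalk" where
  "path_between G v u = (THE p. pre_digraph.awalk G v p u)"

definition path_monomial :: "('e \<Rightarrow> 'l) \<Rightarrow> 'e awalk \<Rightarrow> 'l mpol" where
  "path_monomial \<theta> p = (\<Prod>e \<in> set p. mvar (\<theta> e))"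

definition interpolating_poly :: "('v, 'e) pre_digraph \<Rightarrow> ('e \<Rightarrow> 'l) \<Rightarrow> 'v \<Rightarrow> 'l mpol" where
  "interpolating_poly G \<theta> v =
    (\<Sum>l \<in> {l \<in> leaves G. v \<rightarrow>\<^sup>*\<^bsub>G\<^esub> l}. path_monomial \<theta> (path_between G v l))"


section \<open>The two ring maps and their kernels\<close>

text \<open>The indeterminates \<open>p\<^sub>1, \<dots>, p\<^sub>n\<close> are indexed by the root-to-leaf paths themselves.\<close>

definition path_ring :: "('v, 'e) pre_digraph \<Rightarrow> 'v \<Rightarrow> 'e awalk mpol ring" where
  "path_ring G v0 = mpol_ring (root_leaf_paths G v0)"

definition label_ring :: "('v, 'e) pre_digraph \<Rightarrow> ('e \<Rightarrow> 'l) \<Rightarrow> 'l mpol ring" where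
  "label_ring G \<theta> = mpol_ring (\<theta> ` arcs G)"

definition theta_ideal :: "('v, 'e) pre_digraph \<Rightarrow> ('e \<Rightarrow> 'l) \<Rightarrow> 'l mpol set" where
  "theta_ideal G \<theta> =
    Idl\<^bsub>label_ring G \<theta>\<^esub> {(\<Sum>e \<in> out_arcs G v. mvar (\<theta> e)) - 1 | v. v \<in> nonleaves G}"

definition phi_toric :: "('e \<Rightarrow> 'l) \<Rightarrow> 'e awalk mpol \<Rightarrow> 'l mpol" where
  "phi_toric \<theta> = mpol_subst (path_monomial \<theta>)"

definition phi :: "('v, 'e) pre_digraph \<Rightarrow> ('e \<Rightarrow> 'l) \<Rightarrow> 'e awalk mpol \<Rightarrow> 'l mpol set" where
  "phi G \<theta> f = theta_ideal G \<theta> +>\<^bsub>label_ring G \<theta>\<^esub> phi_toric \<theta> f"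

definition ker_toric :: "('v, 'e) pre_digraph \<Rightarrow> 'v \<Rightarrow> ('e \<Rightarrow> 'l) \<Rightarrow> 'e awalk mpol set" where
  "ker_toric G v0 \<theta> = a_kernel (path_ring G v0) (label_ring G \<theta>) (phi_toric \<theta>)"

text \<open>
  By convention the kernel of \<open>phi\<close> is taken as a homogeneous ideal, that is, it is generated by
  the homogeneous polynomials in the set-theoretic kernel.
\<close>

definition ker_phi :: "('v, 'e) pre_digraph \<Rightarrow> 'v \<Rightarrow> ('e \<Rightarrow> 'l) \<Rightarrow> 'e awalk mpol set" where
  "ker_phi G v0 \<theta> =
    Idl\<^bsub>path_ring G v0\<^esub>
      {f \<in> a_kernel (path_ring G v0) (label_ring G \<theta> Quot theta_ideal G \<theta>) (phi G \<theta>).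
        homogeneous f}"

end

theory Submission
  imports Defs
begin

text \<open>
  Modulo the stage relations every interpolating polynomial \<open>t(v)\<close> is \<open>1\<close>. Writing \<open>p[u]\<close> for the
  sum of the indeterminates of the paths through \<open>u\<close>, the toric map sends \<open>p[u]\<close> to the monomial
  of the path from the root to \<open>u\<close> times \<open>t(u)\<close>. So, for \<open>v\<close> and \<open>w\<close> in the same stage, the
  quadric \<open>p[v_i] p[w_j] - p[w_i] p[v_j]\<close> is sent to a monomial times
  \<open>t(v_i) t(w_j) - t(w_i) t(v_j)\<close>, which vanishes modulo the stage relations. If the kernels are
  equal it already vanishes in the polynomial ring, and cancelling the monomial gives the condition
  (\<open>balanced_if_ker_phi_subset\<close>).

  Conversely, since \<open>t(v)\<close> is the sum of \<open>\<theta>(v,v_i) t(v_i)\<close>, the condition says exactly what is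
  needed for the quotient \<open>\<rho> = t(v) / t(v_i)\<close> to depend on the label of the edge \<open>(v,v_i)\<close> only
  (\<open>tail_head_cross_product\<close>). Along a root-to-leaf path these quotients telescope to \<open>t(v0)\<close>.
  Hence the labels can be rescaled by any power of \<open>\<rho>\<close>, and this multiplies all path monomials by
  one common factor. Two such rescalings prove the two inclusions.

  \<^item> Dividing the labels by \<open>\<rho>\<close> makes the labels at every vertex sum to \<open>1\<close>. If \<open>f\<close> is homogeneous
    and its image lies in the ideal of the stage relations, this image therefore vanishes at the
    rescaled labels; by homogeneity it also vanishes at the original ones
    (\<open>ker_phi_subset_ker_toric\<close>).
  \<^item> Multiplying the labels by powers of \<open>\<rho>\<close> shows that the toric kernel contains the homogeneous
    components of its elements (\<open>hom_component_in_ker_toric\<close>), and a homogeneous element of it is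
    among the generators of the other kernel.

  The quotients are not polynomials, but they are defined and nonzero at all points with positive
  real labels, and a polynomial that vanishes at these points is zero (\<open>mpol_eqI_positive\<close>). So
  all polynomial identities are proved by evaluation at such points.
\<close>

section \<open>Substitution and evaluation of polynomials\<close>

lemma mpol_carrier_add:
  "\<lbrakk>f \<in> carrier (mpol_ring X); g \<in> carrier (mpol_ring X)\<rbrakk> \<Longrightarrow> f + g \<in> carrier (mpol_ring X)"
  using cring.cring_simprules(1)[OF cring_mpol_ring, of f X g]
  by (simp del: mpol_ring_simps(1))

lemma mpol_carrier_mult:
  "\<lbrakk>f \<in> carrier (mpol_ring X); g \<in> carrier (mpol_ring X)\<rbrakk> \<Longrightarrow> f * g \<in> carrier (mpol_ring X)"
  using cring.cring_simprules(5)[OF cring_mpol_ring, of f X g]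
  by (simp del: mpol_ring_simps(1))

lemma mpol_carrier_mconst: "mconst c \<in> carrier (mpol_ring X)"
  by (simp add: mconst_def)

lemma mpol_carrier_one: "1 \<in> carrier (mpol_ring X)"
  by simp

lemma mpol_carrier_mvar: "x \<in> X \<Longrightarrow> mvar x \<in> carrier (mpol_ring X)"
  by (simp add: mvar_def)

lemma mpol_carrier_diff:
  assumes "f \<in> carrier (mpol_ring X)" "g \<in> carrier (mpol_ring X)"
  shows "f - g \<in> carrier (mpol_ring X)"
proof -
  have "- g \<in> carrier (mpol_ring X)"
    using assms(2) by simp
  from mpol_carrier_add[OF assms(1) this] show ?thesis
    by (simp del: mpol_ring_simps(1))
qed

lemma mpol_carrier_sum:
  "(\<And>i. i \<in> A \<Longrightarrow> f i \<in> carrier (mpol_ring X)) \<Longrightarrow> sum f A \<in> carrier (mpol_ring X)"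
  by (induction A rule: infinite_finite_induct)
    (simp_all add: mpol_carrier_add del: mpol_ring_simps(1), simp_all)

lemma mpol_carrier_prod:
  "(\<And>i. i \<in> A \<Longrightarrow> f i \<in> carrier (mpol_ring X)) \<Longrightarrow> prod f A \<in> carrier (mpol_ring X)"
  by (induction A rule: infinite_finite_induct)
    (simp_all add: mpol_carrier_mult mpol_carrier_one del: mpol_ring_simps(1))

lemma mpol_carrier_power:
  "f \<in> carrier (mpol_ring X) \<Longrightarrow> f ^ n \<in> carrier (mpol_ring X)"
  by (induction n) (simp_all add: mpol_carrier_mult mpol_carrier_one del: mpol_ring_simps(1))

lemma mpol_subst_carrier:
  assumes g: "\<And>x. x \<in> X \<Longrightarrow> g x \<in> carrier (mpol_ring Y)" and f: "f \<in> carrier (mpol_ring X)"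
  shows "mpol_subst g f \<in> carrier (mpol_ring Y)"
  unfolding mpol_subst_def
  using f by (intro mpol_carrier_sum mpol_carrier_mult mpol_carrier_mconst mpol_carrier_prod
      mpol_carrier_power g) auto

lemma mpol_subst_ring_hom:
  assumes "\<And>x. x \<in> X \<Longrightarrow> g x \<in> carrier (mpol_ring Y)"
  shows "ring_hom_ring (mpol_ring X) (mpol_ring Y) (mpol_subst g)"
proof (rule ring_hom_ringI2)
  show "ring (mpol_ring X)" "ring (mpol_ring Y)"
    by (simp_all add: cring.axioms(1) cring_mpol_ring)
  have "mpol_subst g 1 = 1"
    using mpol_subst_mconst[of g 1] by (simp add: mconst_def)
  then show "mpol_subst g \<in> ring_hom (mpol_ring X) (mpol_ring Y)"
    by (intro ring_hom_memI)
      (simp_all add: mpol_subst_add mpol_subst_mult mpol_subst_carrier[OF assms]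
        del: mpol_ring_simps(1))
qed

lemma mpol_subst_diff: "mpol_subst g (f - h) = mpol_subst g f - mpol_subst g h"
  using mpol_subst_add[of g "f - h" h] by simp

lemma mpol_subst_sum: "mpol_subst g (sum f A) = (\<Sum>i\<in>A. mpol_subst g (f i))"
  by (induction A rule: infinite_finite_induct)
    (simp_all add: mpol_subst_add mpol_subst_def[of _ 0])

lemma mconst_0: "mconst 0 = 0" and mconst_1: "mconst 1 = 1"
  by (simp_all add: mconst_def)

lemma mconst_add: "mconst (c + d) = mconst c + mconst d"
  by (simp add: mconst_def single_add)

lemma mconst_mult: "mconst (c * d) = mconst c * mconst d"
  by (simp add: mconst_def mult_single)

lemma mconst_power: "mconst (c ^ n) = mconst c ^ n"
  by (induction n) (simp_all add: mconst_1 mconst_mult)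

lemma mconst_sum: "mconst (sum c A) = (\<Sum>i\<in>A. mconst (c i))"
  by (induction A rule: infinite_finite_induct) (simp_all add: mconst_0 mconst_add)

lemma mconst_prod: "mconst (prod c A) = (\<Prod>i\<in>A. mconst (c i))"
  by (induction A rule: infinite_finite_induct) (simp_all add: mconst_1 mconst_mult)

lemma mconst_eq_iff: "mconst c = mconst d \<longleftrightarrow> c = d"
  by (metis mconst_def lookup_single_eq)

definition mono_eval :: "('x \<Rightarrow> real) \<Rightarrow> ('x \<Rightarrow>\<^sub>0 nat) \<Rightarrow> real" where
  "mono_eval a m = (\<Prod>x \<in> Poly_Mapping.keys m. a x ^ Poly_Mapping.lookup m x)"

definition meval :: "('x \<Rightarrow> real) \<Rightarrow> 'x mpol \<Rightarrow> real" where
  "meval a f = (\<Sum>m \<in> Poly_Mapping.keys f. Poly_Mapping.lookup f m * mono_eval a m)"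

text \<open>
  Evaluating at a real point is substituting constants, so the homomorphism laws of \<open>meval\<close> are
  those of \<open>mpol_subst\<close>.
\<close>

lemma mpol_subst_point: "mpol_subst (\<lambda>x. mconst (a x)) f = mconst (meval a f)"
  by (simp add: mpol_subst_def meval_def mono_eval_def mconst_sum mconst_mult mconst_prod
      mconst_power)

lemma meval_add: "meval a (f + g) = meval a f + meval a g"
  using mpol_subst_add[of "\<lambda>x. mconst (a x) :: 'a mpol" f g]
  by (simp add: mpol_subst_point mconst_eq_iff flip: mconst_add)

lemma meval_mult: "meval a (f * g) = meval a f * meval a g"
  using mpol_subst_mult[of "\<lambda>x. mconst (a x) :: 'a mpol" f g]
  by (simp add: mpol_subst_point mconst_eq_iff flip: mconst_mult)

lemma meval_mconst: "meval a (mconst c) = c"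
  using mpol_subst_mconst[of "\<lambda>x. mconst (a x) :: 'a mpol" c]
  by (simp add: mpol_subst_point mconst_eq_iff)

lemma meval_mvar: "meval a (mvar x) = a x"
  using mpol_subst_mvar[of "\<lambda>x. mconst (a x) :: 'a mpol" x]
  by (simp add: mpol_subst_point mconst_eq_iff)

lemma meval_0: "meval a 0 = 0" and meval_1: "meval a 1 = 1"
  using meval_mconst[of a 0] meval_mconst[of a 1] by (simp_all add: mconst_0 mconst_1)

lemma meval_diff: "meval a (f - g) = meval a f - meval a g"
  using meval_add[of a "f - g" g] by simp

lemma meval_sum: "meval a (sum f A) = (\<Sum>i\<in>A. meval a (f i))"
  by (induction A rule: infinite_finite_induct) (simp_all add: meval_0 meval_add)

lemma meval_prod: "meval a (prod f A) = (\<Prod>i\<in>A. meval a (f i))"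
  by (induction A rule: infinite_finite_induct) (simp_all add: meval_1 meval_mult)

lemma meval_power: "meval a (f ^ n) = meval a f ^ n"
  by (induction n) (simp_all add: meval_1 meval_mult)

lemma meval_subst: "meval a (mpol_subst g f) = meval (\<lambda>x. meval a (g x)) f"
  by (simp add: mpol_subst_def meval_def[of _ f] mono_eval_def meval_sum meval_mult meval_mconst
      meval_prod meval_power)

lemma meval_cong:
  assumes "f \<in> carrier (mpol_ring X)" and "\<And>x. x \<in> X \<Longrightarrow> a x = b x"
  shows "meval a f = meval b f"
proof -
  have "a x = b x" if "m \<in> Poly_Mapping.keys f" "x \<in> Poly_Mapping.keys m" for m x
    using assms that by (metis mpol_ring_simps(1) subsetD)
  then show ?thesis
    by (simp add: meval_def mono_eval_def)
qed

lemma mono_eval_mult: "mono_eval (\<lambda>x. a x * b x) m = mono_eval a m * mono_eval b m"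
  by (simp add: mono_eval_def power_mult_distrib prod.distrib)

lemma mono_eval_const: "mono_eval (\<lambda>_. c) m = c ^ mono_degree m"
  by (simp add: mono_eval_def mono_degree_def power_sum)

lemma mono_eval_single_variable: "mono_eval ((\<lambda>_. 1)(x := c)) m = c ^ Poly_Mapping.lookup m x"
proof -
  have "mono_eval ((\<lambda>_. 1)(x := c)) m =
      (\<Prod>y \<in> Poly_Mapping.keys m. if y = x then c ^ Poly_Mapping.lookup m x else 1)"
    unfolding mono_eval_def by (intro prod.cong) auto
  then show ?thesis
    by (simp add: prod.delta' in_keys_iff)
qed


section \<open>Independence of multiplicative functions\<close>

text \<open>
  This is the argument of Artin for linear independence of characters: multiplying a relation by
  the value of one character at \<open>y\<close>, and subtracting it from the relation translated by \<open>y\<close>,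
  removes that character and keeps, with a nonzero factor, any other one that takes a different
  value at \<open>y\<close>.
\<close>

lemma multiplicative_functions_independent:
  fixes \<chi> :: "'k \<Rightarrow> 'a \<Rightarrow> real"
  assumes "finite K"
    and closed: "\<And>x y. \<lbrakk>x \<in> S; y \<in> S\<rbrakk> \<Longrightarrow> opr x y \<in> S"
    and mult: "\<And>k x y. \<lbrakk>x \<in> S; y \<in> S\<rbrakk> \<Longrightarrow> \<chi> k (opr x y) = \<chi> k x * \<chi> k y"
    and nonzero: "\<And>k. \<exists>x\<in>S. \<chi> k x \<noteq> 0"
    and separated: "\<And>k l. k \<noteq> l \<Longrightarrow> \<exists>x\<in>S. \<chi> k x \<noteq> \<chi> l x"
    and relation: "\<And>x. x \<in> S \<Longrightarrow> (\<Sum>k\<in>K. c k * \<chi> k x) = 0"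
  shows "\<forall>k\<in>K. c k = 0"
  using assms(1) relation
proof (induction K arbitrary: c rule: finite_induct)
  case empty
  then show ?case by simp
next
  case (insert k K)
  have rest: "c l = 0" if l: "l \<in> K" for l
  proof -
    from l insert.hyps have "l \<noteq> k" by auto
    then obtain y where y: "y \<in> S" "\<chi> l y \<noteq> \<chi> k y" using separated by blast
    have "\<forall>j\<in>K. c j * (\<chi> j y - \<chi> k y) = 0"
    proof (rule insert.IH)
      fix x assume x: "x \<in> S"
      have "(\<Sum>j\<in>K. c j * (\<chi> j y - \<chi> k y) * \<chi> j x) =
          (\<Sum>j\<in>insert k K. c j * \<chi> j (opr x y)) - \<chi> k y * (\<Sum>j\<in>insert k K. c j * \<chi> j x)"
        using insert.hyps x y
        by (simp add: mult algebra_simps sum_subtractf sum_distrib_left)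
      also have "\<dots> = 0"
        using insert.prems x y closed by simp
      finally show "(\<Sum>j\<in>K. c j * (\<chi> j y - \<chi> k y) * \<chi> j x) = 0" .
    qed
    with l y show ?thesis by auto
  qed
  moreover obtain x where "x \<in> S" "\<chi> k x \<noteq> 0" using nonzero by blast
  with insert.prems[of x] insert.hyps rest have "c k = 0" by simp
  ultimately show ?case by simp
qed

text \<open>
  Distinct monomials are distinct multiplicative functions on the points with positive coordinates,
  hence linearly independent there.
\<close>

lemma mpol_eqI_positive:
  assumes "\<And>a. (\<And>x. a x > 0) \<Longrightarrow> meval a f = meval a g"
  shows "f = g"
proof -
  let ?h = "f - g"
  have "\<forall>m \<in> Poly_Mapping.keys ?h. Poly_Mapping.lookup ?h m = 0"
  proof (rule multiplicative_functions_independent[where \<chi> = "\<lambda>m a. mono_eval a m"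
        and S = "{a. \<forall>x. a x > 0}" and opr = "\<lambda>a b x. a x * b x"])
    show "\<exists>a\<in>{a. \<forall>x. a x > 0}. mono_eval a m \<noteq> 0" for m :: "'a \<Rightarrow>\<^sub>0 nat"
      by (intro bexI[of _ "\<lambda>_. 1"]) (simp_all add: mono_eval_const)
    show "\<exists>a\<in>{a. \<forall>x. a x > 0}. mono_eval a m \<noteq> mono_eval a m'"
      if neq: "m \<noteq> m'" for m m' :: "'a \<Rightarrow>\<^sub>0 nat"
    proof -
      from neq obtain x where "Poly_Mapping.lookup m x \<noteq> Poly_Mapping.lookup m' x"
        by (auto intro: poly_mapping_eqI)
      \<comment> \<open>with all other coordinates \<open>1\<close>, setting \<open>x\<close> to \<open>2\<close> reads off the exponent of \<open>x\<close>\<close>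
      then show ?thesis
        by (intro bexI[of _ "(\<lambda>_. 1)(x := 2)"]) (auto simp: mono_eval_single_variable)
    qed
    show "(\<Sum>m \<in> Poly_Mapping.keys ?h. Poly_Mapping.lookup ?h m * mono_eval a m) = 0"
      if "a \<in> {a. \<forall>x. a x > 0}" for a
      using assms[of a] that meval_diff[of a f g] by (simp add: meval_def)
  qed (simp_all add: mono_eval_mult)
  then have "Poly_Mapping.keys ?h = {}"
    by (auto simp only: in_keys_iff)
  then show ?thesis
    by (metis keys_eq_empty right_minus_eq)
qed


section \<open>Homogeneous components\<close>

definition hom_component :: "nat \<Rightarrow> 'x mpol \<Rightarrow> 'x mpol" where
  "hom_component d f =
    (\<Sum>m \<in> {m \<in> Poly_Mapping.keys f. mono_degree m = d}.
      Poly_Mapping.single m (Poly_Mapping.lookup f m))"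

lemma lookup_hom_component:
  "Poly_Mapping.lookup (hom_component d f) m =
    (if mono_degree m = d then Poly_Mapping.lookup f m else 0)"
  by (auto simp: hom_component_def lookup_sum lookup_single when_def sum.delta in_keys_iff)

lemma keys_hom_component:
  "Poly_Mapping.keys (hom_component d f) = {m \<in> Poly_Mapping.keys f. mono_degree m = d}"
  by (auto simp: in_keys_iff lookup_hom_component split: if_splits)

lemma sum_hom_components: "(\<Sum>d \<in> mono_degree ` Poly_Mapping.keys f. hom_component d f) = f"
  by (rule poly_mapping_eqI)
    (auto simp: lookup_sum lookup_hom_component sum.delta in_keys_iff)

lemma mono_degree_add: "mono_degree (a + b) = mono_degree a + mono_degree b"
proof -
  let ?A = "Poly_Mapping.keys a \<union> Poly_Mapping.keys b"
  have ext: "mono_degree m = (\<Sum>x \<in> ?A. Poly_Mapping.lookup m x)"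
    if "Poly_Mapping.keys m \<subseteq> ?A" for m
    unfolding mono_degree_def using that
    by (intro sum.mono_neutral_left) (auto simp: in_keys_iff)
  show ?thesis
    using Poly_Mapping.keys_add[of a b] by (simp add: ext lookup_add sum.distrib)
qed

lemma keys_mult_degree:
  assumes "\<And>m. m \<in> Poly_Mapping.keys f \<Longrightarrow> mono_degree m = d"
    and "\<And>m. m \<in> Poly_Mapping.keys g \<Longrightarrow> mono_degree m = e"
    and "m \<in> Poly_Mapping.keys (f * g)"
  shows "mono_degree m = d + e"
  using assms keys_mult[of f g] by (auto simp: mono_degree_add)

lemma meval_scale_homogeneous:
  assumes "\<And>m. m \<in> Poly_Mapping.keys f \<Longrightarrow> mono_degree m = d"
  shows "meval (\<lambda>x. a x * c) f = c ^ d * meval a f"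
  unfolding meval_def using assms
  by (auto simp: mono_eval_mult mono_eval_const sum_distrib_left intro!: sum.cong)

lemma meval_scale:
  "meval (\<lambda>x. a x * c) f =
    (\<Sum>d \<in> mono_degree ` Poly_Mapping.keys f. c ^ d * meval a (hom_component d f))"
proof -
  have "meval (\<lambda>x. a x * c) f =
      (\<Sum>d \<in> mono_degree ` Poly_Mapping.keys f. meval (\<lambda>x. a x * c) (hom_component d f))"
    by (simp add: sum_hom_components flip: meval_sum)
  also have "\<dots> = (\<Sum>d \<in> mono_degree ` Poly_Mapping.keys f. c ^ d * meval a (hom_component d f))"
    by (intro sum.cong refl meval_scale_homogeneous) (simp add: keys_hom_component)
  finally show ?thesis .
qed

text \<open>
  Scaling by \<open>b ^ k\<close> multiplies the component of degree \<open>d\<close> by \<open>(b ^ d) ^ k\<close>, and for \<open>b > 1\<close>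
  these are pairwise different multiplicative functions of \<open>k\<close>.
\<close>

lemma hom_components_vanish:
  assumes b: "b > (1 :: real)" and zero: "\<And>k. meval (\<lambda>x. a x * b ^ k) f = 0"
  shows "meval a (hom_component d f) = 0"
proof (cases "d \<in> mono_degree ` Poly_Mapping.keys f")
  case True
  have "\<forall>d \<in> mono_degree ` Poly_Mapping.keys f. meval a (hom_component d f) = 0"
  proof (rule multiplicative_functions_independent[where \<chi> = "\<lambda>d k. (b ^ d) ^ k"
        and S = "UNIV :: nat set" and opr = "(+)"])
    show "\<exists>k\<in>UNIV. (b ^ d) ^ k \<noteq> (b ^ d') ^ k" if "d \<noteq> d'" for d d' :: nat
      using that b by (intro bexI[of _ 1]) auto
    show "(\<Sum>d \<in> mono_degree ` Poly_Mapping.keys f. meval a (hom_component d f) * (b ^ d) ^ k) = 0"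
      for k
      using zero[of k] by (simp add: meval_scale mult.commute flip: power_mult)
  qed (use b in \<open>auto simp: power_add\<close>)
  with True show ?thesis by blast
next
  case False
  then have "hom_component d f = 0"
    by (auto simp: keys_hom_component simp flip: keys_eq_empty)
  then show ?thesis by (simp add: meval_0)
qed


section \<open>Walks in a rooted tree\<close>

context rooted_tree
begin

text \<open>Prefixing the walk from the root to \<open>u\<close> reduces this to uniqueness of walks from the root.\<close>

lemma walk_unique:
  assumes "awalk u p v" "awalk u q v"
  shows "p = q"
proof -
  obtain r where r: "awalk v0 r u"
    using unique_walk_from_root assms(1) by (meson awalk_hd_in_verts)
  have "awalk v0 (r @ p) v" "awalk v0 (r @ q) v"
    using r assms by (auto intro: awalk_appendI)
  moreover have "\<exists>!r. awalk v0 r v"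
    using assms(1) by (intro unique_walk_from_root awalk_last_in_verts)
  ultimately have "r @ p = r @ q" by blast
  then show ?thesis by simp
qed

lemma path_between_eq: "awalk u p v \<Longrightarrow> path_between G u v = p"
  unfolding path_between_def by (blast intro: the_equality walk_unique)

lemma awalk_path_between: "u \<rightarrow>\<^sup>* v \<Longrightarrow> awalk u (path_between G u v) v"
  by (auto simp: reachable_awalk path_between_eq)

lemma reachable_from_root: "v \<in> verts G \<Longrightarrow> v0 \<rightarrow>\<^sup>* v"
  using unique_walk_from_root[of v] by (auto simp: reachable_awalk)

text \<open>
  A repeated arc would give a nonempty closed walk beside the empty walk at the same vertex.
  Products over the set of arcs of a walk are therefore products along the walk.
\<close>

lemma walk_distinct:
  assumes "awalk u p v"
  shows "distinct p"
proof (rule ccontr)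
  assume "\<not> distinct p"
  then obtain xs ys zs e where p: "p = xs @ [e] @ ys @ [e] @ zs"
    using not_distinct_decomp by blast
  from assms have "awalk (tail G e) (e # ys) (tail G e)"
    unfolding p by (auto simp: awalk_Cons_iff)
  moreover from this have "awalk (tail G e) [] (tail G e)"
    by (simp add: awalk_Nil_iff awalk_hd_in_verts)
  ultimately show False using walk_unique by blast
qed

text \<open>
  The distance from the root increases along every arc, so the finite digraph has no cycles and
  induction from the leaves upwards is possible.
\<close>

lemma induct_towards_root [consumes 1, case_names vertex]:
  assumes "v \<in> verts G"
    and step: "\<And>v. \<lbrakk>v \<in> verts G; \<And>e. e \<in> out_arcs G v \<Longrightarrow> P (head G e)\<rbrakk> \<Longrightarrow> P v"
  shows "P v"
proof -
  let ?r = "(\<lambda>e. (tail G e, head G e)) ` arcs G"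
  have "?r \<subseteq> measure (\<lambda>v. length (path_between G v0 v))"
  proof clarsimp
    fix e assume e: "e \<in> arcs G"
    then have "awalk v0 (path_between G v0 (tail G e)) (tail G e)"
      by (simp add: awalk_path_between reachable_from_root)
    moreover have "awalk (tail G e) [e] (head G e)"
      using e by (simp add: arc_implies_awalk)
    ultimately show "length (path_between G v0 (tail G e)) < length (path_between G v0 (head G e))"
      using path_between_eq[OF awalk_appendI] by fastforce
  qed
  then have "acyclic ?r" by (meson wf_acyclic wf_measure wf_subset)
  then have "wf (?r\<inverse>)" by (simp add: finite_acyclic_wf_converse)
  then have "v \<in> verts G \<longrightarrow> P v"
  proof (induction v rule: wf_induct_rule)
    case (less v)
    show ?case
    proof
      assume v: "v \<in> verts G"
      show "P v"
      proof (rule step[OF v])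
        fix e assume "e \<in> out_arcs G v"
        then have "(head G e, v) \<in> ?r\<inverse>" "head G e \<in> verts G" by (auto simp: image_iff)
        with less show "P (head G e)" by blast
      qed
    qed
  qed
  with assms(1) show ?thesis by blast
qed

lemma finite_leaves: "finite (leaves G)"
  by (simp add: leaves_def)

definition leaves_below :: "'v \<Rightarrow> 'v set" where
  "leaves_below v = {l \<in> leaves G. v \<rightarrow>\<^sup>* l}"

lemma finite_leaves_below: "finite (leaves_below v)"
  by (simp add: leaves_below_def finite_leaves)

lemma leaves_below_leaf: "v \<in> leaves G \<Longrightarrow> leaves_below v = {v}"
proof (intro equalityI subsetI)
  fix l assume "v \<in> leaves G" "l \<in> leaves_below v"
  moreover from this obtain p where "awalk v p l" by (auto simp: leaves_below_def reachable_awalk)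
  ultimately show "l \<in> {v}"
    by (cases p) (auto simp: awalk_Cons_iff awalk_Nil_iff leaves_def out_arcs_def)
qed (auto simp: leaves_below_def leaves_def)

lemma leaves_below_nonleaf:
  assumes v: "v \<in> nonleaves G"
  shows "leaves_below v = (\<Union>e \<in> out_arcs G v. leaves_below (head G e))"
proof (intro equalityI subsetI)
  fix l assume l: "l \<in> leaves_below v"
  then obtain p where p: "awalk v p l" by (auto simp: leaves_below_def reachable_awalk)
  with l v obtain e q where "p = e # q"
    by (cases p) (auto simp: nonleaves_def leaves_below_def awalk_Nil_iff)
  with p l show "l \<in> (\<Union>e \<in> out_arcs G v. leaves_below (head G e))"
    by (auto simp: awalk_Cons_iff leaves_below_def intro!: reachable_awalkI)
next
  fix l assume "l \<in> (\<Union>e \<in> out_arcs G v. leaves_below (head G e))"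
  then obtain e where e: "e \<in> out_arcs G v" and l: "l \<in> leaves G" "head G e \<rightarrow>\<^sup>* l"
    by (auto simp: leaves_below_def)
  then have "awalk v (e # path_between G (head G e) l) l"
    by (auto simp: awalk_Cons_iff awalk_path_between)
  with l(1) show "l \<in> leaves_below v"
    by (auto simp: leaves_below_def intro: reachable_awalkI)
qed

lemma path_between_Cons:
  assumes "e \<in> out_arcs G v" "head G e \<rightarrow>\<^sup>* l"
  shows "path_between G v l = e # path_between G (head G e) l"
  using assms by (intro path_between_eq) (auto simp: awalk_Cons_iff awalk_path_between)

lemma leaves_below_disjoint:
  assumes "e \<in> out_arcs G v" "f \<in> out_arcs G v" "e \<noteq> f"
  shows "leaves_below (head G e) \<inter> leaves_below (head G f) = {}"
proof (rule ccontr)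
  assume "leaves_below (head G e) \<inter> leaves_below (head G f) \<noteq> {}"
  then obtain l where "head G e \<rightarrow>\<^sup>* l" "head G f \<rightarrow>\<^sup>* l"
    by (auto simp: leaves_below_def)
  then have "path_between G v l = e # path_between G (head G e) l"
    and "path_between G v l = f # path_between G (head G f) l"
    using path_between_Cons[OF assms(1)] path_between_Cons[OF assms(2)] by blast+
  with assms(3) show False by simp
qed

lemma path_monomial_append:
  "awalk u (p @ q) w \<Longrightarrow> path_monomial \<theta> (p @ q) = path_monomial \<theta> p * path_monomial \<theta> q"
  using walk_distinct[of u "p @ q" w] by (simp add: path_monomial_def prod.union_disjoint)

lemma path_monomial_Cons:
  "awalk u (e # q) w \<Longrightarrow> path_monomial \<theta> (e # q) = mvar (\<theta> e) * path_monomial \<theta> q"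
  using walk_distinct[of u "e # q" w] by (simp add: path_monomial_def)

lemma interpolating_poly_leaf: "v \<in> leaves G \<Longrightarrow> interpolating_poly G \<theta> v = 1"
  unfolding interpolating_poly_def leaves_below_def[symmetric]
  by (simp add: leaves_below_leaf path_monomial_def path_between_eq[of v "[]" v] awalk_Nil_iff)
    (simp add: leaves_def path_between_eq[of v "[]" v] awalk_Nil_iff)

lemma interpolating_poly_nonleaf:
  assumes "v \<in> nonleaves G"
  shows "interpolating_poly G \<theta> v =
    (\<Sum>e \<in> out_arcs G v. mvar (\<theta> e) * interpolating_poly G \<theta> (head G e))"
proof -
  have "path_monomial \<theta> (path_between G v l) =
      mvar (\<theta> e) * path_monomial \<theta> (path_between G (head G e) l)"
    if "e \<in> out_arcs G v" "l \<in> leaves_below (head G e)" for e l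
  proof -
    from that have r: "head G e \<rightarrow>\<^sup>* l" by (simp add: leaves_below_def)
    from that(1) r have "awalk v (e # path_between G (head G e) l) l"
      by (auto simp: awalk_Cons_iff awalk_path_between)
    then show ?thesis
      by (simp add: path_between_Cons[OF that(1) r] path_monomial_Cons)
  qed
  then show ?thesis
    unfolding interpolating_poly_def leaves_below_def[symmetric] leaves_below_nonleaf[OF assms]
    by (subst sum.UNION_disjoint)
      (auto simp: finite_leaves_below sum_distrib_left dest: leaves_below_disjoint
        intro!: sum.cong)
qed

text \<open>
  The linear form \<open>p[v]\<close>: the walk from the root to a leaf below \<open>v\<close> passes through \<open>v\<close>, so
  the summands are the indeterminates of the root-to-leaf paths through \<open>v\<close>.
\<close>

definition paths_through :: "'v \<Rightarrow> 'e awalk mpol" where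
  "paths_through v = (\<Sum>l \<in> leaves_below v. mvar (path_between G v0 l))"

lemma root_leaf_path_between: "l \<in> leaves G \<Longrightarrow> path_between G v0 l \<in> root_leaf_paths G v0"
  using awalk_path_between reachable_from_root by (auto simp: root_leaf_paths_def leaves_def)

lemma paths_through_carrier: "paths_through v \<in> carrier (path_ring G v0)"
  unfolding paths_through_def path_ring_def
  by (intro mpol_carrier_sum mpol_carrier_mvar root_leaf_path_between)
    (simp add: leaves_below_def)

text \<open>All paths through \<open>v\<close> share their part from the root to \<open>v\<close>.\<close>

lemma phi_toric_paths_through:
  assumes "v \<in> verts G"
  shows "phi_toric \<theta> (paths_through v) =
    path_monomial \<theta> (path_between G v0 v) * interpolating_poly G \<theta> v"
proof -
  have "path_monomial \<theta> (path_between G v0 l) =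
      path_monomial \<theta> (path_between G v0 v) * path_monomial \<theta> (path_between G v l)"
    if "l \<in> leaves_below v" for l
  proof -
    have "awalk v0 (path_between G v0 v @ path_between G v l) l"
      using that assms
      by (intro awalk_appendI[of _ _ v] awalk_path_between reachable_from_root)
        (auto simp: leaves_below_def)
    from path_between_eq[OF this] path_monomial_append[OF this] show ?thesis by simp
  qed
  then show ?thesis
    by (simp add: phi_toric_def paths_through_def mpol_subst_sum interpolating_poly_def
        leaves_below_def[symmetric] sum_distrib_left)
qed

lemma keys_paths_through: "m \<in> Poly_Mapping.keys (paths_through v) \<Longrightarrow> mono_degree m = 1"
  using keys_sum[of "\<lambda>l. mvar (path_between G v0 l)" "leaves_below v"]
  by (auto simp: paths_through_def mvar_def mono_degree_def)

end


section \<open>The two kernels of a staged tree\<close>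

context staged_tree
begin

abbreviation t :: "'v \<Rightarrow> 'l mpol" where
  "t \<equiv> interpolating_poly G \<theta>"

lemma tail_nonleaf: "e \<in> arcs G \<Longrightarrow> tail G e \<in> nonleaves G"
  by (auto simp: nonleaves_def leaves_def)

lemma nonleaf_in_verts: "v \<in> nonleaves G \<Longrightarrow> v \<in> verts G"
  by (simp add: nonleaves_def)

lemma same_label_same_stage:
  "\<lbrakk>e \<in> arcs G; f \<in> arcs G; \<theta> e = \<theta> f\<rbrakk> \<Longrightarrow> (tail G e, tail G f) \<in> stage"
  using different_stage[of "tail G e" "tail G f"] tail_nonleaf by fastforce

lemma stage_nonleaves: "(v, w) \<in> stage \<Longrightarrow> v \<in> nonleaves G \<and> w \<in> nonleaves G"
  using equiv_stage by (auto simp: equiv_def refl_on_def)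

lemma root_nonleaf: "v0 \<in> nonleaves G"
proof -
  obtain e where e: "e \<in> arcs G" using has_arc by blast
  then obtain p where p: "awalk v0 p (tail G e)"
    using unique_walk_from_root[of "tail G e"] by auto
  show ?thesis
  proof (cases p)
    case Nil
    with p e show ?thesis by (auto simp: awalk_Nil_iff tail_nonleaf)
  next
    case (Cons f q)
    with p show ?thesis using tail_nonleaf[of f] by (auto simp: awalk_Cons_iff)
  qed
qed

lemma meval_t_nonleaf:
  "v \<in> nonleaves G \<Longrightarrow> meval x (t v) = (\<Sum>e \<in> out_arcs G v. x (\<theta> e) * meval x (t (head G e)))"
  by (simp add: interpolating_poly_nonleaf meval_sum meval_mult meval_mvar)

lemma meval_t_pos:
  assumes "v \<in> verts G" and x: "\<And>l. x l > 0"
  shows "meval x (t v) > 0"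
  using assms(1)
proof (induction v rule: induct_towards_root)
  case (vertex v)
  show ?case
  proof (cases "v \<in> leaves G")
    case True
    then show ?thesis by (simp add: interpolating_poly_leaf meval_1)
  next
    case False
    with vertex have "v \<in> nonleaves G" "out_arcs G v \<noteq> {}"
      by (auto simp: nonleaves_def leaves_def)
    then show ?thesis
      using vertex.IH x by (simp only: meval_t_nonleaf) (intro sum_pos mult_pos_pos, auto)
  qed
qed

text \<open>
  At the point with all labels \<open>1\<close>, \<open>t(v)\<close> counts the leaves below \<open>v\<close>, and the tree branches at
  the root. Scaling by a power of this number can thus tell degrees apart.
\<close>

lemma meval_t_root_gt_1: "meval (\<lambda>_. 1) (t v0) > 1"
proof -
  have ge1: "meval (\<lambda>_. 1) (t v) \<ge> real (card (out_arcs G v)) \<and> meval (\<lambda>_. 1) (t v) \<ge> 1"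
    if "v \<in> verts G" for v
    using that
  proof (induction v rule: induct_towards_root)
    case (vertex v)
    show ?case
    proof (cases "v \<in> leaves G")
      case True
      then show ?thesis by (simp add: interpolating_poly_leaf meval_1) (simp add: leaves_def)
    next
      case False
      with vertex have v: "v \<in> nonleaves G" by (simp add: nonleaves_def)
      have "real (card (out_arcs G v)) \<le> meval (\<lambda>_. 1) (t v)"
        using sum_mono[of "out_arcs G v" "\<lambda>_. 1 :: real" "\<lambda>e. meval (\<lambda>_. 1) (t (head G e))"]
          vertex.IH by (simp add: meval_t_nonleaf[OF v])
      with branching[OF v] show ?thesis by (simp add: out_degree_def)
    qed
  qed
  show ?thesis
    using ge1[OF root_in_verts] branching[OF root_nonleaf] by (simp add: out_degree_def)
qed

lemma meval_path_monomial: "meval x (path_monomial \<theta> p) = (\<Prod>e \<in> set p. x (\<theta> e))"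
  by (simp add: path_monomial_def meval_prod meval_mvar)

lemma path_monomial_carrier: "set p \<subseteq> arcs G \<Longrightarrow> path_monomial \<theta> p \<in> carrier (label_ring G \<theta>)"
  unfolding path_monomial_def label_ring_def
  by (intro mpol_carrier_prod mpol_carrier_mvar) auto

lemma root_leaf_path_arcs: "p \<in> root_leaf_paths G v0 \<Longrightarrow> set p \<subseteq> arcs G"
  by (auto simp: root_leaf_paths_def)

lemma t_carrier: "t v \<in> carrier (label_ring G \<theta>)"
  unfolding interpolating_poly_def
proof (unfold label_ring_def, rule mpol_carrier_sum, fold label_ring_def)
  fix l assume "l \<in> {l \<in> leaves G. v \<rightarrow>\<^sup>* l}"
  then have "awalk v (path_between G v l) l" by (simp add: awalk_path_between)
  then show "path_monomial \<theta> (path_between G v l) \<in> carrier (label_ring G \<theta>)"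
    by (intro path_monomial_carrier) auto
qed


subsection \<open>The ideal of the stage relations\<close>

lemma generators_carrier:
  "{(\<Sum>e \<in> out_arcs G v. mvar (\<theta> e)) - 1 | v. v \<in> nonleaves G} \<subseteq> carrier (label_ring G \<theta>)"
proof clarify
  fix v
  show "(\<Sum>e \<in> out_arcs G v. mvar (\<theta> e)) - 1 \<in> carrier (label_ring G \<theta>)"
    unfolding label_ring_def
    by (intro mpol_carrier_diff mpol_carrier_sum mpol_carrier_mvar mpol_carrier_one) auto
qed

lemma ideal_theta_ideal: "ideal (theta_ideal G \<theta>) (label_ring G \<theta>)"
  unfolding theta_ideal_def
  by (rule ring.genideal_ideal[OF _ generators_carrier])
    (simp add: label_ring_def cring.axioms(1) cring_mpol_ring)

lemma theta_ideal_generator: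
  "v \<in> nonleaves G \<Longrightarrow> (\<Sum>e \<in> out_arcs G v. mvar (\<theta> e)) - 1 \<in> theta_ideal G \<theta>"
  using ring.genideal_self[OF _ generators_carrier]
  by (fastforce simp: theta_ideal_def label_ring_def cring.axioms(1) cring_mpol_ring
      simp del: mpol_ring_simps(1))

lemma theta_ideal_add:
  "\<lbrakk>f \<in> theta_ideal G \<theta>; g \<in> theta_ideal G \<theta>\<rbrakk> \<Longrightarrow> f + g \<in> theta_ideal G \<theta>"
  using additive_subgroup.a_closed[OF ideal.axioms(1)[OF ideal_theta_ideal], of f g]
  by (simp add: label_ring_def)

lemma theta_ideal_mult:
  "\<lbrakk>f \<in> theta_ideal G \<theta>; g \<in> carrier (label_ring G \<theta>)\<rbrakk> \<Longrightarrow> g * f \<in> theta_ideal G \<theta>"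
  using ideal.I_l_closed[OF ideal_theta_ideal, of f g]
  by (simp add: label_ring_def del: mpol_ring_simps(1))

lemma theta_ideal_0: "0 \<in> theta_ideal G \<theta>"
  using additive_subgroup.zero_closed[OF ideal.axioms(1)[OF ideal_theta_ideal]]
  by (simp add: label_ring_def)

lemma theta_ideal_diff:
  assumes "f \<in> theta_ideal G \<theta>" "g \<in> theta_ideal G \<theta>"
  shows "f - g \<in> theta_ideal G \<theta>"
proof -
  have "mconst (- 1) * g \<in> theta_ideal G \<theta>"
    using assms(2) by (intro theta_ideal_mult) (simp_all add: label_ring_def mpol_carrier_mconst
        del: mpol_ring_simps(1))
  moreover have "mconst (- 1) = (- 1 :: 'l mpol)"
    by (simp add: mconst_def single_uminus)
  ultimately show ?thesis using theta_ideal_add[OF assms(1), of "- g"] by simp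
qed

lemma theta_ideal_sum:
  "(\<And>i. i \<in> A \<Longrightarrow> f i \<in> theta_ideal G \<theta>) \<Longrightarrow> sum f A \<in> theta_ideal G \<theta>"
  by (induction A rule: infinite_finite_induct) (simp_all add: theta_ideal_0 theta_ideal_add)

text \<open>
  From the leaves upwards: once all \<open>t(v_i)\<close> are \<open>1\<close>, \<open>t(v)\<close> is the sum of the labels at \<open>v\<close>.
\<close>

lemma t_cong_1: "v \<in> verts G \<Longrightarrow> t v - 1 \<in> theta_ideal G \<theta>"
proof (induction v rule: induct_towards_root)
  case (vertex v)
  show ?case
  proof (cases "v \<in> leaves G")
    case True
    then show ?thesis by (simp add: interpolating_poly_leaf theta_ideal_0)
  next
    case False
    with vertex have v: "v \<in> nonleaves G" by (simp add: nonleaves_def)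
    have "t v - 1 = (\<Sum>e \<in> out_arcs G v. mvar (\<theta> e) * (t (head G e) - 1)) +
        ((\<Sum>e \<in> out_arcs G v. mvar (\<theta> e)) - 1)"
      by (simp add: interpolating_poly_nonleaf[OF v] right_diff_distrib sum_subtractf)
    also have "\<dots> \<in> theta_ideal G \<theta>"
      by (intro theta_ideal_add theta_ideal_generator v theta_ideal_sum theta_ideal_mult vertex.IH)
        (auto simp: label_ring_def simp del: mpol_ring_simps(1) intro!: mpol_carrier_mvar)
    finally show ?thesis .
  qed
qed

text \<open>
  The polynomials vanishing at \<open>s\<close> form an ideal, as the kernel of the evaluation map into the ring
  of constants, which is represented here by the polynomials without indeterminates.
\<close>

lemma theta_ideal_vanishes:
  assumes s: "\<And>v. v \<in> nonleaves G \<Longrightarrow> (\<Sum>e \<in> out_arcs G v. s (\<theta> e)) = 1"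
    and f: "f \<in> theta_ideal G \<theta>"
  shows "meval s f = 0"
proof -
  let ?h = "mpol_subst (\<lambda>l. mconst (s l) :: 'l mpol)"
  let ?K = "a_kernel (label_ring G \<theta>) (mpol_ring {} :: 'l mpol ring) ?h"
  have hom: "ring_hom_ring (label_ring G \<theta>) (mpol_ring {} :: 'l mpol ring) ?h"
    unfolding label_ring_def by (rule mpol_subst_ring_hom) (rule mpol_carrier_mconst)
  have K: "?K = {f \<in> carrier (label_ring G \<theta>). meval s f = 0}"
    using mconst_eq_iff[of _ 0] by (auto simp: a_kernel_def' mpol_subst_point mconst_0)
  have "theta_ideal G \<theta> \<subseteq> ?K"
    unfolding theta_ideal_def
  proof (rule ring.genideal_minimal[OF _ ring_hom_ring.kernel_is_ideal[OF hom]])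
    show "ring (label_ring G \<theta>)"
      by (simp add: label_ring_def cring.axioms(1) cring_mpol_ring)
    have "meval s ((\<Sum>e \<in> out_arcs G v. mvar (\<theta> e)) - 1) = 0" if "v \<in> nonleaves G" for v
      using s[OF that] by (simp add: meval_diff meval_sum meval_mvar meval_1)
    then show "{(\<Sum>e \<in> out_arcs G v. mvar (\<theta> e)) - 1 | v. v \<in> nonleaves G} \<subseteq> ?K"
      unfolding K using generators_carrier by blast
  qed
  with f K show ?thesis by blast
qed


subsection \<open>Membership in the kernels\<close>

lemma ring_hom_phi_toric: "ring_hom_ring (path_ring G v0) (label_ring G \<theta>) (phi_toric \<theta>)"
  unfolding path_ring_def label_ring_def phi_toric_def
  using path_monomial_carrier root_leaf_path_arcs
  by (intro mpol_subst_ring_hom) (simp add: label_ring_def del: mpol_ring_simps(1))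

lemma ideal_ker_toric: "ideal (ker_toric G v0 \<theta>) (path_ring G v0)"
  unfolding ker_toric_def by (rule ring_hom_ring.kernel_is_ideal[OF ring_hom_phi_toric])

lemma ker_toric_iff:
  "f \<in> ker_toric G v0 \<theta> \<longleftrightarrow> f \<in> carrier (path_ring G v0) \<and> phi_toric \<theta> f = 0"
  by (simp add: ker_toric_def a_kernel_def' label_ring_def)

lemma kernel_phi_iff:
  "f \<in> a_kernel (path_ring G v0) (label_ring G \<theta> Quot theta_ideal G \<theta>) (phi G \<theta>) \<longleftrightarrow>
    f \<in> carrier (path_ring G v0) \<and> phi_toric \<theta> f \<in> theta_ideal G \<theta>"
proof -
  have "theta_ideal G \<theta> +>\<^bsub>label_ring G \<theta>\<^esub> a = theta_ideal G \<theta> \<longleftrightarrow> a \<in> theta_ideal G \<theta>"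
    if "a \<in> carrier (label_ring G \<theta>)" for a
    using that ideal_theta_ideal ideal.rcos_const_imp_mem
      abelian_subgroup.a_rcos_const[OF abelian_subgroupI3[OF ideal.axioms(1)]]
      ring.is_abelian_group[OF ideal.axioms(2)] by metis
  moreover have "phi_toric \<theta> f \<in> carrier (label_ring G \<theta>)" if "f \<in> carrier (path_ring G v0)"
    using that ring_hom_closed[OF ring_hom_ring.homh[OF ring_hom_phi_toric]] by blast
  ultimately show ?thesis
    by (auto simp: a_kernel_def' phi_def FactRing_def)
qed

lemma ring_path_ring: "ring (path_ring G v0)"
  by (simp add: path_ring_def cring.axioms(1) cring_mpol_ring)

lemma ker_phi_generators_carrier:
  "{f \<in> a_kernel (path_ring G v0) (label_ring G \<theta> Quot theta_ideal G \<theta>) (phi G \<theta>). homogeneous f}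
    \<subseteq> carrier (path_ring G v0)"
  using kernel_phi_iff by blast

lemma ideal_ker_phi: "ideal (ker_phi G v0 \<theta>) (path_ring G v0)"
  unfolding ker_phi_def by (rule ring.genideal_ideal[OF ring_path_ring ker_phi_generators_carrier])

lemma homogeneous_in_ker_phi:
  "\<lbrakk>f \<in> carrier (path_ring G v0); homogeneous f; phi_toric \<theta> f \<in> theta_ideal G \<theta>\<rbrakk>
    \<Longrightarrow> f \<in> ker_phi G v0 \<theta>"
  unfolding ker_phi_def
  using ring.genideal_self[OF ring_path_ring ker_phi_generators_carrier] kernel_phi_iff by blast

lemma ker_phi_subset_ker_toricI:
  assumes "\<And>f. \<lbrakk>f \<in> carrier (path_ring G v0); homogeneous f; phi_toric \<theta> f \<in> theta_ideal G \<theta>\<rbrakk>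
    \<Longrightarrow> phi_toric \<theta> f = 0"
  shows "ker_phi G v0 \<theta> \<subseteq> ker_toric G v0 \<theta>"
  unfolding ker_phi_def
  using assms by (intro ring.genideal_minimal[OF ring_path_ring ideal_ker_toric])
    (auto simp: kernel_phi_iff ker_toric_iff)

lemma ker_phi_sum:
  "(\<And>i. i \<in> A \<Longrightarrow> f i \<in> ker_phi G v0 \<theta>) \<Longrightarrow> sum f A \<in> ker_phi G v0 \<theta>"
proof (induction A rule: infinite_finite_induct)
  case (insert i A)
  then show ?case
    using additive_subgroup.a_closed[OF ideal.axioms(1)[OF ideal_ker_phi], of "f i" "sum f A"]
    by (simp add: path_ring_def)
qed (use additive_subgroup.zero_closed[OF ideal.axioms(1)[OF ideal_ker_phi]] in
    \<open>simp_all add: path_ring_def\<close>)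

lemma meval_phi_toric:
  "meval x (phi_toric \<theta> f) = meval (\<lambda>p. \<Prod>e \<in> set p. x (\<theta> e)) f"
  by (simp add: phi_toric_def meval_subst meval_path_monomial)


subsection \<open>From equal kernels to the condition on interpolating polynomials\<close>

lemma path_monomial_to_head:
  assumes "e \<in> out_arcs G v"
  shows "path_monomial \<theta> (path_between G v0 (head G e)) =
    path_monomial \<theta> (path_between G v0 v) * mvar (\<theta> e)"
proof -
  have walk: "awalk v0 (path_between G v0 v @ [e]) (head G e)"
    using assms by (intro awalk_appendI[of _ _ v] awalk_path_between reachable_from_root)
      (auto simp: arc_implies_awalk)
  from path_between_eq[OF walk] path_monomial_append[OF walk] show ?thesis
    by (simp add: path_monomial_def)
qed

text \<open>
  The quadric \<open>p[v_i] p[w_j] - p[w_i] p[v_j]\<close> carries the argument: it is homogeneous of degree \<open>2\<close>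
  and both products have the same image modulo the stage relations.
\<close>

lemma balanced_if_ker_phi_subset:
  assumes sub: "ker_phi G v0 \<theta> \<subseteq> ker_toric G v0 \<theta>"
    and vw: "(v, w) \<in> stage"
    and e: "e \<in> out_arcs G v" "f \<in> out_arcs G v" "e' \<in> out_arcs G w" "f' \<in> out_arcs G w"
    and labels: "\<theta> e = \<theta> e'" "\<theta> f = \<theta> f'"
  shows "t (head G e) * t (head G f') = t (head G e') * t (head G f)"
proof -
  define q where "q = paths_through (head G e) * paths_through (head G f') -
    paths_through (head G e') * paths_through (head G f)"
  define c where "c = path_monomial \<theta> (path_between G v0 v) *
    path_monomial \<theta> (path_between G v0 w) * mvar (\<theta> e) * mvar (\<theta> f)"
  define d where "d = t (head G e) * t (head G f') - t (head G e') * t (head G f)"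
  have verts: "v \<in> verts G" "w \<in> verts G"
    using vw stage_nonleaves nonleaf_in_verts by blast+
  have heads: "head G e \<in> verts G" "head G f \<in> verts G" "head G e' \<in> verts G" "head G f' \<in> verts G"
    using e by auto
  have "phi_toric \<theta> q =
      phi_toric \<theta> (paths_through (head G e)) * phi_toric \<theta> (paths_through (head G f')) -
      phi_toric \<theta> (paths_through (head G e')) * phi_toric \<theta> (paths_through (head G f))"
    by (simp add: q_def phi_toric_def mpol_subst_diff mpol_subst_mult)
  also have "\<dots> = c * d"
    using labels
    by (simp add: phi_toric_paths_through heads path_monomial_to_head[OF e(1)]
        path_monomial_to_head[OF e(2)] path_monomial_to_head[OF e(3)]
        path_monomial_to_head[OF e(4)] c_def d_def algebra_simps)
  finally have image: "phi_toric \<theta> q = c * d" .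
  have "d = (t (head G e) * (t (head G f') - 1) + (t (head G e) - 1)) -
      (t (head G e') * (t (head G f) - 1) + (t (head G e') - 1))"
    by (simp add: d_def algebra_simps)
  also have "\<dots> \<in> theta_ideal G \<theta>"
    by (intro theta_ideal_diff theta_ideal_add theta_ideal_mult t_cong_1 heads t_carrier)
  finally have "d \<in> theta_ideal G \<theta>" .
  moreover have "c \<in> carrier (label_ring G \<theta>)"
  proof -
    have "set (path_between G v0 u) \<subseteq> arcs G" if "u \<in> verts G" for u
      using awalk_path_between[OF reachable_from_root[OF that]] by auto
    from this[THEN path_monomial_carrier] verts e show ?thesis
      unfolding c_def label_ring_def
      by (intro mpol_carrier_mult mpol_carrier_mvar) auto
  qed
  ultimately have "phi_toric \<theta> q \<in> theta_ideal G \<theta>"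
    unfolding image by (rule theta_ideal_mult)
  moreover have "q \<in> carrier (path_ring G v0)"
    using paths_through_carrier unfolding q_def path_ring_def
    by (intro mpol_carrier_diff mpol_carrier_mult) blast+
  moreover have "homogeneous q"
    unfolding homogeneous_def
  proof (intro exI ballI)
    fix m assume "m \<in> Poly_Mapping.keys q"
    then have "m \<in> Poly_Mapping.keys (paths_through (head G e) * paths_through (head G f')) \<or>
        m \<in> Poly_Mapping.keys (paths_through (head G e') * paths_through (head G f))"
      using keys_diff[of "paths_through (head G e) * paths_through (head G f')"
        "paths_through (head G e') * paths_through (head G f)"] unfolding q_def by blast
    then show "mono_degree m = 1 + 1"
      using keys_mult_degree keys_paths_through by blast
  qed
  ultimately have "q \<in> ker_phi G v0 \<theta>"
    by (intro homogeneous_in_ker_phi)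
  with sub image have "c * d = 0"
    by (auto simp: ker_toric_iff)
  have "meval x (t (head G e) * t (head G f')) = meval x (t (head G e') * t (head G f))"
    if x: "\<And>l. x l > 0" for x
  proof -
    have "meval x c > 0"
      using x by (simp add: c_def meval_mult meval_path_monomial meval_mvar prod_pos)
    moreover have "meval x c * meval x d = 0"
      using \<open>c * d = 0\<close> by (metis meval_mult meval_0)
    ultimately have "meval x d = 0" by simp
    then show ?thesis by (simp add: d_def meval_diff)
  qed
  then show ?thesis by (rule mpol_eqI_positive)
qed

end


section \<open>Rescaling the labels of a balanced staged tree\<close>

locale balanced_staged_tree = staged_tree G v0 \<theta> stage
  for G :: "('v, 'e) pre_digraph" (structure) and v0 :: 'v
    and \<theta> :: "'e \<Rightarrow> 'l" and stage :: "('v \<times> 'v) set" +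
  assumes balanced:
    "\<lbrakk>(v, w) \<in> stage; e \<in> out_arcs G v; f \<in> out_arcs G v; e' \<in> out_arcs G w; f' \<in> out_arcs G w;
      \<theta> e = \<theta> e'; \<theta> f = \<theta> f'\<rbrakk> \<Longrightarrow>
      interpolating_poly G \<theta> (head G e) * interpolating_poly G \<theta> (head G f') =
      interpolating_poly G \<theta> (head G e') * interpolating_poly G \<theta> (head G f)"
begin

text \<open>
  This follows by expanding \<open>t\<close> at the two tails over their outgoing arcs, matched by equal labels,
  and applying the condition to each term.
\<close>

lemma tail_head_cross_product:
  assumes e: "e \<in> arcs G" "e' \<in> arcs G" and label: "\<theta> e = \<theta> e'"
  shows "t (head G e) * t (tail G e') = t (head G e') * t (tail G e)"
proof -
  let ?v = "tail G e" and ?w = "tail G e'"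
  have vw: "(?v, ?w) \<in> stage" using same_label_same_stage[OF e label] .
  then have nl: "?v \<in> nonleaves G" "?w \<in> nonleaves G" using stage_nonleaves by auto
  have "\<exists>g. g \<in> out_arcs G ?w \<and> \<theta> g = \<theta> f" if "f \<in> out_arcs G ?v" for f
  proof -
    from that same_stage[OF vw] have "\<theta> f \<in> \<theta> ` out_arcs G ?w" by blast
    then show ?thesis by (elim imageE) auto
  qed
  then obtain h where h: "\<And>f. f \<in> out_arcs G ?v \<Longrightarrow> h f \<in> out_arcs G ?w \<and> \<theta> (h f) = \<theta> f"
    by metis
  have cross: "t (head G e) * t (head G (h f)) = t (head G e') * t (head G f)"
    if "f \<in> out_arcs G ?v" for f
    by (rule balanced[OF vw]) (use that h e label in auto)
  have "bij_betw h (out_arcs G ?v) (out_arcs G ?w)"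
  proof (rule bij_betw_imageI)
    show "inj_on h (out_arcs G ?v)"
      using h labels_distinct[OF nl(1)] unfolding inj_on_def by metis
    show "h ` out_arcs G ?v = out_arcs G ?w"
    proof (intro equalityI subsetI)
      fix g assume g: "g \<in> out_arcs G ?w"
      then obtain f where f: "f \<in> out_arcs G ?v" "\<theta> f = \<theta> g"
        using same_stage[OF vw] by (metis imageE imageI)
      then have "h f = g"
        using h g labels_distinct[OF nl(2)] unfolding inj_on_def by metis
      with f show "g \<in> h ` out_arcs G ?v" by blast
    qed (use h in blast)
  qed
  then have "t ?w = (\<Sum>f \<in> out_arcs G ?v. mvar (\<theta> (h f)) * t (head G (h f)))"
    unfolding interpolating_poly_nonleaf[OF nl(2)] by (rule sum.reindex_bij_betw[symmetric])
  also have "\<dots> = (\<Sum>f \<in> out_arcs G ?v. mvar (\<theta> f) * t (head G (h f)))"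
    using h by (intro sum.cong) auto
  finally have "t (head G e) * t ?w =
      (\<Sum>f \<in> out_arcs G ?v. mvar (\<theta> f) * (t (head G e) * t (head G (h f))))"
    by (simp add: sum_distrib_left mult.left_commute)
  also have "\<dots> = (\<Sum>f \<in> out_arcs G ?v. mvar (\<theta> f) * (t (head G e') * t (head G f)))"
    using cross by simp
  also have "\<dots> = t (head G e') * t ?v"
    by (simp add: interpolating_poly_nonleaf[OF nl(1)] sum_distrib_left mult.left_commute)
  finally show ?thesis .
qed

text \<open>
  The value at \<open>x\<close> of \<open>t(v) / t(v_i)\<close> for an arbitrarily chosen arc \<open>(v,v_i)\<close> with label \<open>l\<close>.
\<close>

definition ratio :: "('l \<Rightarrow> real) \<Rightarrow> 'l \<Rightarrow> real" where
  "ratio x l = (let e = (SOME e. e \<in> arcs G \<and> \<theta> e = l)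
    in meval x (t (tail G e)) / meval x (t (head G e)))"

context
  fixes x :: "'l \<Rightarrow> real"
  assumes pos: "\<And>l. x l > 0"
begin

text \<open>The value is the same for every arc with the given label.\<close>

lemma ratio_label:
  assumes e: "e \<in> arcs G"
  shows "ratio x (\<theta> e) = meval x (t (tail G e)) / meval x (t (head G e))"
proof -
  define e' where "e' = (SOME e'. e' \<in> arcs G \<and> \<theta> e' = \<theta> e)"
  have e': "e' \<in> arcs G" "\<theta> e' = \<theta> e"
    unfolding e'_def using someI[of "\<lambda>e'. e' \<in> arcs G \<and> \<theta> e' = \<theta> e" e] e by auto
  have "meval x (t (head G e')) * meval x (t (tail G e)) =
      meval x (t (head G e)) * meval x (t (tail G e'))"
    using tail_head_cross_product[OF e'(1) e e'(2)] by (simp flip: meval_mult)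
  moreover have "meval x (t (head G e)) > 0" "meval x (t (head G e')) > 0"
    using e e' pos by (auto intro: meval_t_pos)
  ultimately show ?thesis
    by (simp add: ratio_def Let_def flip: e'_def) (simp add: field_simps)
qed

text \<open>The product telescopes, since the head of each arc is the tail of the following one.\<close>

lemma ratio_walk:
  "awalk u p w \<Longrightarrow> (\<Prod>e \<in> set p. ratio x (\<theta> e)) = meval x (t u) / meval x (t w)"
proof (induction p arbitrary: u)
  case Nil
  then show ?case using meval_t_pos[of w x] pos by (auto simp: awalk_Nil_iff)
next
  case (Cons e p)
  then have "awalk (head G e) p w" "e \<in> arcs G" "tail G e = u" "e \<notin> set p"
    using walk_distinct[OF Cons.prems] by (auto simp: awalk_Cons_iff)
  moreover from this have "meval x (t (head G e)) > 0"
    using pos by (intro meval_t_pos) auto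
  ultimately show ?case using Cons.IH by (simp add: ratio_label)
qed

lemma ratio_root_leaf_path:
  "p \<in> root_leaf_paths G v0 \<Longrightarrow> (\<Prod>e \<in> set p. ratio x (\<theta> e)) = meval x (t v0)"
  by (auto simp: root_leaf_paths_def ratio_walk interpolating_poly_leaf meval_1)

text \<open>
  The label \<open>\<theta>(v,v_i) t(v_i) / t(v)\<close> is the fraction of \<open>t(v)\<close> that is contributed by the paths
  through \<open>v_i\<close>.
\<close>

lemma sum_normalized_labels:
  assumes v: "v \<in> nonleaves G"
  shows "(\<Sum>e \<in> out_arcs G v. x (\<theta> e) / ratio x (\<theta> e)) = 1"
proof -
  have "(\<Sum>e \<in> out_arcs G v. x (\<theta> e) / ratio x (\<theta> e)) =
      (\<Sum>e \<in> out_arcs G v. x (\<theta> e) * meval x (t (head G e)) / meval x (t v))"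
    by (intro sum.cong refl) (auto simp: ratio_label)
  also have "\<dots> = meval x (t v) / meval x (t v)"
    unfolding sum_divide_distrib[symmetric] by (simp only: meval_t_nonleaf[OF v])
  also have "\<dots> = 1"
    using meval_t_pos[of v x] nonleaf_in_verts[OF v] pos by simp
  finally show ?thesis .
qed

lemma meval_phi_toric_normalized:
  assumes "f \<in> carrier (path_ring G v0)" and "\<And>m. m \<in> Poly_Mapping.keys f \<Longrightarrow> mono_degree m = d"
  shows "meval (\<lambda>l. x l / ratio x l) (phi_toric \<theta> f) =
    (1 / meval x (t v0)) ^ d * meval x (phi_toric \<theta> f)"
proof -
  have "meval (\<lambda>l. x l / ratio x l) (phi_toric \<theta> f) =
      meval (\<lambda>p. (\<Prod>e \<in> set p. x (\<theta> e)) * (1 / meval x (t v0))) f"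
    unfolding meval_phi_toric
    by (rule meval_cong[OF assms(1)[unfolded path_ring_def]])
      (simp add: prod_dividef ratio_root_leaf_path)
  then show ?thesis
    using meval_scale_homogeneous[OF assms(2)] by (simp only: meval_phi_toric)
qed

end

lemma ker_phi_subset_ker_toric: "ker_phi G v0 \<theta> \<subseteq> ker_toric G v0 \<theta>"
proof (rule ker_phi_subset_ker_toricI)
  fix f
  assume f: "f \<in> carrier (path_ring G v0)" "homogeneous f" "phi_toric \<theta> f \<in> theta_ideal G \<theta>"
  then obtain d where d: "\<And>m. m \<in> Poly_Mapping.keys f \<Longrightarrow> mono_degree m = d"
    by (auto simp: homogeneous_def)
  show "phi_toric \<theta> f = 0"
  proof (rule mpol_eqI_positive)
    fix x :: "'l \<Rightarrow> real" assume x: "\<And>l. x l > 0"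
    have "(1 / meval x (t v0)) ^ d * meval x (phi_toric \<theta> f) = 0"
      using theta_ideal_vanishes[OF sum_normalized_labels[of x, OF x] f(3)]
        meval_phi_toric_normalized[of x, OF x f(1) d] by simp
    then show "meval x (phi_toric \<theta> f) = meval x 0"
      using meval_t_pos[of v0 x] root_in_verts x by (simp add: meval_0)
  qed
qed

text \<open>
  The ratios at the all-ones point are real numbers attached to the labels, whose product along each
  root-to-leaf path is the number of leaves. Multiplying the labels of an arbitrary point by the
  \<open>k\<close>-th powers of these ratios scales all path monomials by the \<open>k\<close>-th power of this number, and
  the scaled values of an element of the kernel are still zero.
\<close>

lemma hom_component_in_ker_toric:
  assumes f: "f \<in> ker_toric G v0 \<theta>"
  shows "hom_component d f \<in> ker_toric G v0 \<theta>"
proof -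
  let ?r = "ratio (\<lambda>_. 1)"
  have carrier: "f \<in> carrier (path_ring G v0)" and zero: "phi_toric \<theta> f = 0"
    using f by (simp_all add: ker_toric_iff)
  have "phi_toric \<theta> (hom_component d f) = 0"
  proof (rule mpol_eqI_positive)
    fix x :: "'l \<Rightarrow> real"
    have "meval (\<lambda>p. (\<Prod>e \<in> set p. x (\<theta> e)) * meval (\<lambda>_. 1) (t v0) ^ k) f = 0" for k
    proof -
      have "meval (\<lambda>p. (\<Prod>e \<in> set p. x (\<theta> e)) * meval (\<lambda>_. 1) (t v0) ^ k) f =
          meval (\<lambda>l. x l * ?r l ^ k) (phi_toric \<theta> f)"
        unfolding meval_phi_toric
        by (rule meval_cong[OF carrier[unfolded path_ring_def]])
          (simp add: prod.distrib ratio_root_leaf_path flip: prod_power_distrib)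
      then show ?thesis by (simp add: zero meval_0)
    qed
    from hom_components_vanish[OF meval_t_root_gt_1 this]
    show "meval x (phi_toric \<theta> (hom_component d f)) = meval x 0"
      by (simp add: meval_phi_toric meval_0)
  qed
  moreover have "hom_component d f \<in> carrier (path_ring G v0)"
    using carrier by (simp add: path_ring_def keys_hom_component)
  ultimately show ?thesis by (simp add: ker_toric_iff)
qed

lemma ker_toric_subset_ker_phi: "ker_toric G v0 \<theta> \<subseteq> ker_phi G v0 \<theta>"
proof
  fix f assume f: "f \<in> ker_toric G v0 \<theta>"
  have "hom_component d f \<in> ker_phi G v0 \<theta>" for d
  proof (rule homogeneous_in_ker_phi)
    show "homogeneous (hom_component d f)"
      by (auto simp: homogeneous_def keys_hom_component)
  qed (use hom_component_in_ker_toric[OF f, of d] theta_ideal_0 in \<open>auto simp: ker_toric_iff\<close>)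
  then show "f \<in> ker_phi G v0 \<theta>"
    using ker_phi_sum[of "mono_degree ` Poly_Mapping.keys f" "\<lambda>d. hom_component d f"]
    by (simp add: sum_hom_components)
qed

end


section \<open>Equality of the kernels\<close>

theorem theorem10:
  fixes G :: "('v, 'e) pre_digraph" and v0 :: 'v
    and \<theta> :: "'e \<Rightarrow> 'l" and stage :: "('v \<times> 'v) set"
  assumes "staged_tree G v0 \<theta> stage"
  shows "ker_toric G v0 \<theta> = ker_phi G v0 \<theta> \<longleftrightarrow>
    (\<forall>v w. (v, w) \<in> stage \<longrightarrow>
      (\<forall>e\<^sub>i \<in> out_arcs G v. \<forall>e\<^sub>j \<in> out_arcs G v. \<forall>f\<^sub>i \<in> out_arcs G w. \<forall>f\<^sub>j \<in> out_arcs G w.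
        \<theta> e\<^sub>i = \<theta> f\<^sub>i \<and> \<theta> e\<^sub>j = \<theta> f\<^sub>j \<longrightarrow>
        interpolating_poly G \<theta> (head G e\<^sub>i) * interpolating_poly G \<theta> (head G f\<^sub>j) =
        interpolating_poly G \<theta> (head G f\<^sub>i) * interpolating_poly G \<theta> (head G e\<^sub>j)))"
    (is "_ \<longleftrightarrow> ?balanced")
proof
  interpret staged_tree G v0 \<theta> stage by fact
  assume "ker_toric G v0 \<theta> = ker_phi G v0 \<theta>"
  then show ?balanced
    using balanced_if_ker_phi_subset by simp
next
  assume ?balanced
  with assms interpret balanced_staged_tree G v0 \<theta> stage
    unfolding balanced_staged_tree_def balanced_staged_tree_axioms_def by simp
  show "ker_toric G v0 \<theta> = ker_phi G v0 \<theta>"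
    using ker_toric_subset_ker_phi ker_phi_subset_ker_toric by (rule equalityI)
qed

end
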